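(* Let $S\subseteq\mathbb{F}_2^n$ be a powerful set and let $\mathbf{v}\in S$ be a nonzero vector. Define $S+\Box\setminus\mathbf{v}\subseteq\mathbb{F}_2^{n+1}$ by \[S+\Box\setminus\mathbf{v}:=\{\mathbf{0}0,\ \mathbf{v}0\}\cup\{\mathbf{u}1\mid \mathbf{u}\in S\setminus\{\mathbf{0},\mathbf{v}\}\},\] where $\mathbf{u}a$ denotes the vector of length $n+1$ obtained by appending the bit $a$ to $\mathbf{u}$. Then $S+\Box\setminus\mathbf{v}$ is a powerful set.
   Context: A set $S\subseteq\mathbb{F}_2^n$ (positions indexed by $[n]=\{1,\dots,n\}$) is called a powerful set if for every $X\subseteq[n]$ the number of vectors in $S$ whose coordinates in all positions of $X$ are zero is a power of $2$. *)

theory Defs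
  imports "Jordan_Normal_Form.Matrix" "HOL-Library.Z2"
begin

text \<open>
  The space $F_2^n$ is \<^term>\<open>carrier_vec n :: bit vec set\<close>. Vector entries are numbered from 0,
  so position $i$ of $\{1,\dots,n\}$ is the index $i - 1$ and $\{1,\dots,n\}$ becomes
  \<^term>\<open>{..<n}\<close>.
\<close>

definition powerful_set :: "nat \<Rightarrow> bit vec set \<Rightarrow> bool" where
  "powerful_set n S \<longleftrightarrow>
     S \<subseteq> carrier_vec n \<and>
     (\<forall>X \<subseteq> {..<n}. \<exists>k. card {u \<in> S. \<forall>i\<in>X. u $ i = 0} = 2 ^ k)"

definition append_bit :: "bit vec \<Rightarrow> bit \<Rightarrow> bit vec" where
  "append_bit u a = u @\<^sub>v vec_of_list [a]"

text \<open>The set $S + \Box \setminus v$.\<close>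

definition add_box_minus :: "nat \<Rightarrow> bit vec set \<Rightarrow> bit vec \<Rightarrow> bit vec set" where
  "add_box_minus n S v =
     {append_bit (0\<^sub>v n) 0, append_bit v 0} \<union>
     {append_bit u 1 | u. u \<in> S - {0\<^sub>v n, v}}"

end

theory Submission
  imports Defs
begin

text \<open>
  Labelling each $u \in S$ with a bit $f(u)$ appended to it gives a powerful set if and only if both
  $S$ and $\{u \in S \mid f(u) = 0\}$ are powerful: a set of positions avoiding the new one counts
  vectors of $S$, and one containing it counts vectors labelled 0. A powerful set contains
  $\mathbf{0}$, since a power of 2 is never 0, so $S + \Box \setminus v$ is the labelling of $S$ in
  which exactly $\mathbf{0}$ and $v$ receive the bit 0; and $\{\mathbf{0}, v\}$ is powerful,
  all its counts being 1 or 2.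
\<close>

lemma append_bit_carrier: "u \<in> carrier_vec n \<Longrightarrow> append_bit u a \<in> carrier_vec (n + 1)"
  unfolding append_bit_def carrier_vec_def by simp

lemma index_append_bit_less: "u \<in> carrier_vec n \<Longrightarrow> i < n \<Longrightarrow> append_bit u a $ i = u $ i"
  unfolding append_bit_def carrier_vec_def by simp

lemma index_append_bit_last: "u \<in> carrier_vec n \<Longrightarrow> append_bit u a $ n = a"
  unfolding append_bit_def carrier_vec_def by simp

lemma append_bit_eq_iff:
  assumes "u \<in> carrier_vec n" "w \<in> carrier_vec n"
  shows "append_bit u a = append_bit w b \<longleftrightarrow> u = w \<and> a = b"
proof
  assume eq: "append_bit u a = append_bit w b"
  then have "u = w"
    using append_vec_eq[OF assms] by (simp add: append_bit_def)
  moreover have "a = b"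
    using eq assms by (metis index_append_bit_last)
  ultimately show "u = w \<and> a = b" ..
qed simp

definition vanishing_on :: "nat set \<Rightarrow> bit vec set \<Rightarrow> bit vec set" where
  "vanishing_on X S = {u \<in> S. \<forall>i\<in>X. u $ i = 0}"

lemma powerful_set_iff_vanishing_on:
  "powerful_set n S \<longleftrightarrow>
     S \<subseteq> carrier_vec n \<and> (\<forall>X \<subseteq> {..<n}. \<exists>k. card (vanishing_on X S) = 2 ^ k)"
  by (simp add: powerful_set_def vanishing_on_def)

lemma vanishing_on_all_positions:
  assumes "S \<subseteq> carrier_vec n"
  shows "vanishing_on {..<n} S = S \<inter> {0\<^sub>v n}"
proof -
  have "u = 0\<^sub>v n \<longleftrightarrow> (\<forall>i<n. u $ i = 0)" if "u \<in> S" for u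
  proof -
    have "u \<in> carrier_vec n"
      using that assms by blast
    then show ?thesis
      by (simp add: vec_eq_iff)
  qed
  then show ?thesis
    by (auto simp: vanishing_on_def)
qed

lemma zero_in_powerful_set:
  assumes "powerful_set n S"
  shows "0\<^sub>v n \<in> S"
proof -
  obtain k :: nat where "card (vanishing_on {..<n} S) = 2 ^ k" "S \<subseteq> carrier_vec n"
    using assms by (auto simp: powerful_set_iff_vanishing_on)
  then have "card (S \<inter> {0\<^sub>v n}) = 2 ^ k"
    by (simp only: vanishing_on_all_positions)
  then have "card (S \<inter> {0\<^sub>v n}) \<noteq> 0"
    by simp
  then show ?thesis
    by auto
qed

lemma powerful_set_zero_pair:
  assumes "v \<in> carrier_vec n"
  shows "powerful_set n {0\<^sub>v n, v}"
  unfolding powerful_set_iff_vanishing_on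
proof (intro conjI allI impI)
  show "{0\<^sub>v n, v} \<subseteq> carrier_vec n"
    using assms by simp
next
  fix X :: "nat set"
  assume "X \<subseteq> {..<n}"
  then have "0\<^sub>v n \<in> vanishing_on X {0\<^sub>v n, v}"
    by (auto simp: vanishing_on_def)
  moreover have "vanishing_on X {0\<^sub>v n, v} \<subseteq> {0\<^sub>v n, v}"
    by (auto simp: vanishing_on_def)
  ultimately consider (only_zero) "vanishing_on X {0\<^sub>v n, v} = {0\<^sub>v n}"
    | (both) "v \<noteq> 0\<^sub>v n" "vanishing_on X {0\<^sub>v n, v} = {0\<^sub>v n, v}"
    by blast
  then show "\<exists>k. card (vanishing_on X {0\<^sub>v n, v}) = 2 ^ k"
  proof cases
    case only_zero
    then show ?thesis by (intro exI[of _ 0]) simp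
  next
    case both
    then show ?thesis by (intro exI[of _ 1]) simp
  qed
qed

definition append_label :: "(bit vec \<Rightarrow> bit) \<Rightarrow> bit vec set \<Rightarrow> bit vec set" where
  "append_label f S = (\<lambda>u. append_bit u (f u)) ` S"

lemma append_label_subset_carrier:
  "S \<subseteq> carrier_vec n \<Longrightarrow> append_label f S \<subseteq> carrier_vec (n + 1)"
  using append_bit_carrier by (auto simp: append_label_def)

lemma card_append_label:
  assumes "S \<subseteq> carrier_vec n"
  shows "card (append_label f S) = card S"
proof -
  have "inj_on (\<lambda>u. append_bit u (f u)) S"
    using assms append_bit_eq_iff by (intro inj_onI) blast
  then show ?thesis
    by (simp add: append_label_def card_image)
qed

lemma vanishing_on_append_label:
  assumes "S \<subseteq> carrier_vec n" "X \<subseteq> {..<n}"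
  shows "vanishing_on X (append_label f S) = append_label f (vanishing_on X S)"
proof -
  have "append_bit u (f u) $ i = u $ i" if "u \<in> S" "i \<in> X" for u i
    using that assms index_append_bit_less by blast
  then show ?thesis
    by (auto simp: vanishing_on_def append_label_def)
qed

lemma vanishing_on_insert_append_label:
  assumes "S \<subseteq> carrier_vec n" "X \<subseteq> {..<n}"
  shows "vanishing_on (insert n X) (append_label f S) =
    append_label f (vanishing_on X {u \<in> S. f u = 0})"
proof -
  have last: "append_bit u a $ n = a" if "u \<in> S" for u a
    using that assms index_append_bit_last by blast
  have "vanishing_on (insert n X) (append_label f S) =
      {w \<in> vanishing_on X (append_label f S). w $ n = 0}"
    by (auto simp: vanishing_on_def)
  also have "\<dots> = {w \<in> append_label f (vanishing_on X S). w $ n = 0}"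
    by (simp only: vanishing_on_append_label[OF assms])
  also have "\<dots> = (\<lambda>u. append_bit u (f u)) `
      {u \<in> vanishing_on X S. append_bit u (f u) $ n = 0}"
    unfolding append_label_def by blast
  also have "\<dots> = append_label f (vanishing_on X {u \<in> S. f u = 0})"
    unfolding append_label_def by (intro image_cong) (auto simp: vanishing_on_def last)
  finally show ?thesis .
qed

lemma all_subsets_insert:
  "(\<forall>X \<subseteq> insert a A. P X) \<longleftrightarrow> (\<forall>X \<subseteq> A. P X \<and> P (insert a X))"
proof -
  have "(\<forall>X \<in> Pow (insert a A). P X) \<longleftrightarrow> (\<forall>X \<in> Pow A. P X \<and> P (insert a X))"
    by (auto simp only: Pow_insert ball_Un ball_simps)
  then show ?thesis
    by (simp only: Ball_def Pow_iff)
qed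

theorem powerful_set_append_label_iff:
  assumes "S \<subseteq> carrier_vec n"
  shows "powerful_set (n + 1) (append_label f S) \<longleftrightarrow>
    powerful_set n S \<and> powerful_set n {u \<in> S. f u = 0}"
proof -
  have carrier: "vanishing_on X S \<subseteq> carrier_vec n"
    "vanishing_on X {u \<in> S. f u = 0} \<subseteq> carrier_vec n" for X
    using assms by (auto simp: vanishing_on_def)
  have positions: "{..<n + 1} = insert n {..<n}"
    by auto
  have "card (vanishing_on X (append_label f S)) = card (vanishing_on X S)"
    "card (vanishing_on (insert n X) (append_label f S)) = card (vanishing_on X {u \<in> S. f u = 0})"
    if "X \<subseteq> {..<n}" for X
    using assms that
    by (simp_all add: vanishing_on_append_label vanishing_on_insert_append_label
        card_append_label[OF carrier(1)] card_append_label[OF carrier(2)])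
  then show ?thesis
    unfolding powerful_set_iff_vanishing_on positions all_subsets_insert
    using assms append_label_subset_carrier[OF assms] by auto
qed

lemma add_box_minus_eq_append_label:
  assumes "0\<^sub>v n \<in> S" "v \<in> S"
  shows "add_box_minus n S v = append_label (\<lambda>u. of_bool (u \<notin> {0\<^sub>v n, v})) S"
  using assms by (auto simp: add_box_minus_def append_label_def)

theorem theorem5:
  fixes n :: nat and S :: "bit vec set" and v :: "bit vec"
  assumes "powerful_set n S"
    and "v \<in> S"
    and "v \<noteq> 0\<^sub>v n"
  shows "powerful_set (n + 1) (add_box_minus n S v)"
proof -
  let ?f = "\<lambda>u. of_bool (u \<notin> {0\<^sub>v n, v}) :: bit"
  have carrier: "S \<subseteq> carrier_vec n"
    using assms(1) by (simp add: powerful_set_def)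
  have zero: "0\<^sub>v n \<in> S"
    using assms(1) by (rule zero_in_powerful_set)
  have "{u \<in> S. ?f u = 0} = {0\<^sub>v n, v}"
    using zero assms(2) by auto
  moreover have "powerful_set n {0\<^sub>v n, v}"
    using carrier assms(2) by (intro powerful_set_zero_pair) blast
  ultimately have "powerful_set (n + 1) (append_label ?f S)"
    using assms(1) by (simp only: powerful_set_append_label_iff[OF carrier])
  then show ?thesis
    by (simp only: add_box_minus_eq_append_label[OF zero assms(2)])
qed

end
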